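(* Let $1<p_{\min}\le p_{\max}<\infty$, $x_0\in B_1\subset\mathbb{R}^n$, $0<\bar r_1<\bar r_2\le1$, $0<\theta\le1$, let $c_0,c_1,c_2$ be positive constants and let $c_3\in\mathbb{R}$. There exist positive constants $\gamma\ge1$, $\bar c$, $\varepsilon_0$ and $\varepsilon_1$, with the dependences $$\gamma=\gamma(n,p_{\min},p_{\max}),\quad \bar c=\bar c(p_{\min},p_{\max},c_1),\quad \varepsilon_0=\varepsilon_0(n,p_{\min},p_{\max},\bar r_1,c_1),\quad \varepsilon_1=\varepsilon_1(n,p_{\min},p_{\max},\bar r_1,c_0,c_1,\theta),$$ such that the following holds. Let $\varepsilon>0$ and let $p$ be a $C^1$ function on a domain containing $\{\bar r_1\le|x-x_0|\le\bar r_2\}$ with $p_{\min}\le p(x)\le p_{\max}$ and $\|\nabla p\|_{L^\infty}\le\varepsilon^{1+\theta}$. Then the functions $$w(x)=c_1|x-x_0|^{-\gamma}-c_2,\qquad v(x)=q(x)+\frac{c_0}{2}\varepsilon\,(w(x)-1),\qquad q(x)=x_n+c_3,$$ satisfy, for $\bar r_1\le|x-x_0|\le\bar r_2$, $$\Delta_{p(x)}w\ge\bar c\qquad\text{for } 0<\varepsilon\le\varepsilon_0,$$ and $$\frac12\le|\nabla v|\le2,\qquad \Delta_{p(x)}v>\varepsilon^2\qquad\text{for } 0<\varepsilon\le\varepsilon_1.$$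
   Context: $B_1$ is the open unit ball of $\mathbb{R}^n$ centered at $0$. For a $C^2$ function $u$ with $\nabla u(x)\neq0$, $$\Delta_{p(x)}u=\mathrm{div}(|\nabla u|^{p(x)-2}\nabla u)=|\nabla u(x)|^{p(x)-2}\Big(\Delta u+(p(x)-2)\Big\langle D^2u(x)\tfrac{\nabla u(x)}{|\nabla u(x)|},\tfrac{\nabla u(x)}{|\nabla u(x)|}\Big\rangle+\langle\nabla p(x),\nabla u(x)\rangle\log|\nabla u(x)|\Big).$$ *)

theory Defs
  imports "HOL-Analysis.Analysis"
begin

text \<open>
  The dimension \<open>n\<close> is a quantified natural number, because it matters which constants
  may depend on it. So \<open>\<real>\<^sup>n\<close> is the library space \<^term>\<open>Euclidean_space n\<close>: sequences vanishing
  from index \<open>n\<close> on, with the coordinates \<open>x\<^sub>1, \<dots>, x\<^sub>n\<close> stored as \<open>x 0, \<dots>, x (n - 1)\<close>.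
\<close>

definition enorm :: "nat \<Rightarrow> (nat \<Rightarrow> real) \<Rightarrow> real" where
  "enorm n x = L2_set x {..<n}"

definition edist :: "nat \<Rightarrow> (nat \<Rightarrow> real) \<Rightarrow> (nat \<Rightarrow> real) \<Rightarrow> real" where
  "edist n x y = enorm n (\<lambda>i. x i - y i)"

definition partial_deriv :: "nat \<Rightarrow> ((nat \<Rightarrow> real) \<Rightarrow> real) \<Rightarrow> (nat \<Rightarrow> real) \<Rightarrow> real" where
  "partial_deriv i f x = deriv (\<lambda>t. f (x(i := t))) (x i)"

definition grad :: "nat \<Rightarrow> ((nat \<Rightarrow> real) \<Rightarrow> real) \<Rightarrow> (nat \<Rightarrow> real) \<Rightarrow> nat \<Rightarrow> real" where
  "grad n f x = (\<lambda>i. if i < n then partial_deriv i f x else 0)"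

definition divergence :: "nat \<Rightarrow> ((nat \<Rightarrow> real) \<Rightarrow> nat \<Rightarrow> real) \<Rightarrow> (nat \<Rightarrow> real) \<Rightarrow> real" where
  "divergence n F x = (\<Sum>i<n. partial_deriv i (\<lambda>y. F y i) x)"

definition px_laplacian ::
  "nat \<Rightarrow> ((nat \<Rightarrow> real) \<Rightarrow> real) \<Rightarrow> ((nat \<Rightarrow> real) \<Rightarrow> real) \<Rightarrow> (nat \<Rightarrow> real) \<Rightarrow> real" where
  "px_laplacian n p u x =
     divergence n (\<lambda>y i. enorm n (grad n u y) powr (p y - 2) * grad n u y i) x"

definition domain_in :: "nat \<Rightarrow> (nat \<Rightarrow> real) set \<Rightarrow> bool" where
  "domain_in n \<Omega> \<longleftrightarrow>
     \<Omega> \<noteq> {} \<and> openin (Euclidean_space n) \<Omega> \<and> connectedin (Euclidean_space n) \<Omega>"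

definition C1_on :: "nat \<Rightarrow> ((nat \<Rightarrow> real) \<Rightarrow> real) \<Rightarrow> (nat \<Rightarrow> real) set \<Rightarrow> bool" where
  "C1_on n f \<Omega> \<longleftrightarrow>
     (\<forall>i<n. (\<forall>x\<in>\<Omega>. (\<lambda>t. f (x(i := t))) differentiable (at (x i))) \<and>
            continuous_map (subtopology (Euclidean_space n) \<Omega>) euclideanreal (partial_deriv i f))"

definition annulus :: "nat \<Rightarrow> (nat \<Rightarrow> real) \<Rightarrow> real \<Rightarrow> real \<Rightarrow> (nat \<Rightarrow> real) set" where
  "annulus n x\<^sub>0 r\<^sub>1 r\<^sub>2 =
     {x \<in> topspace (Euclidean_space n). r\<^sub>1 \<le> edist n x x\<^sub>0 \<and> edist n x x\<^sub>0 \<le> r\<^sub>2}"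

end

theory Submission
  imports Defs
begin

text \<open>
  Both functions have the form \<open>u(x) = a x\<^sub>n + b |x - z|\<^sup>-\<^sup>s + d\<close>: for \<open>w\<close>, \<open>a = 0\<close> and \<open>b = c\<^sub>1\<close>; for
  \<open>v\<close>, \<open>a = 1\<close> and \<open>b = c\<^sub>0 \<epsilon> c\<^sub>1 / 2\<close>. The linear part does not enter the Hessian. With
  \<open>r = |x - z|\<close> and \<open>e = (x - z) / r\<close>,
  \<open>D\<^sup>2u = b s r\<^sup>-\<^sup>s\<^sup>-\<^sup>2 ((s + 2) e \<otimes> e - I)\<close>. In nondivergence form the \<open>p(x)\<close>-Laplacian is then
  \<open>|\<nabla>u|\<^sup>p\<^sup>-\<^sup>2\<close> times
  \<open>b s r\<^sup>-\<^sup>s\<^sup>-\<^sup>2 (s + 2 - n + (p - 2) ((s + 2) \<sigma> - 1)) + \<langle>\<nabla>p, \<nabla>u\<rangle> log |\<nabla>u|\<close>,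
  where \<open>\<sigma> = \<langle>e, \<nabla>u / |\<nabla>u|\<rangle>\<^sup>2\<close> lies in \<open>[0, 1]\<close>.

  The factor after \<open>b s r\<^sup>-\<^sup>s\<^sup>-\<^sup>2\<close> is affine in \<open>\<sigma>\<close>, so it suffices to bound it for a gradient
  parallel to \<open>e\<close> and for one orthogonal to \<open>e\<close>. Taking \<open>s\<close> large in terms of \<open>n\<close>, \<open>p_min\<close>, \<open>p_max\<close>
  makes it at least \<open>1\<close> in both cases (\<open>barrier_exponent_bracket\<close>), which gives the common estimate
  \<open>px_laplacian_barrier_ge\<close>: if \<open>|\<nabla>p| \<le> \<delta>\<close>, the operator is at least
  \<open>|\<nabla>u|\<^sup>p\<^sup>-\<^sup>2 (b s r\<^sup>-\<^sup>s\<^sup>-\<^sup>2 - \<delta> |\<nabla>u| |log |\<nabla>u||)\<close>.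

  For \<open>w\<close>, the convexity term \<open>b s r\<^sup>-\<^sup>s\<^sup>-\<^sup>2\<close> equals \<open>|\<nabla>w| / r\<close> and hence dominates \<open>|\<nabla>w|\<close>; the
  logarithm is bounded on the annulus, so for small \<open>\<epsilon>\<close> at least \<open>|\<nabla>w|\<^sup>p\<^sup>-\<^sup>1 / 2\<close> survives. Since
  \<open>|\<nabla>w| \<ge> c\<^sub>1\<close> whenever \<open>r \<le> 1\<close>, the resulting constant depends on neither the dimension nor the
  radii. For \<open>v\<close>, the gradient is a small perturbation of a unit vector, the convexity term is of
  order \<open>\<epsilon>\<close> and the logarithmic term of order \<open>\<epsilon>\<^sup>1\<^sup>+\<^sup>\<theta>\<close>, so their difference is of order \<open>\<epsilon>\<close> and beats
  \<open>\<epsilon>\<^sup>2\<close> for small \<open>\<epsilon>\<close>.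
\<close>

section \<open>The variable-exponent Laplacian in nondivergence form\<close>

lemma has_real_derivative_enorm:
  assumes F: "\<And>j. j < n \<Longrightarrow> ((\<lambda>t. F t j) has_real_derivative D j) (at t0)"
    and pos: "enorm n (F t0) > 0"
  shows "((\<lambda>t. enorm n (F t)) has_real_derivative (\<Sum>j<n. F t0 j * D j) / enorm n (F t0)) (at t0)"
proof -
  have eq: "enorm n y = sqrt (\<Sum>j<n. (y j)\<^sup>2)" for y
    by (simp add: enorm_def L2_set_def)
  have gt: "(\<Sum>j<n. (F t0 j)\<^sup>2) > 0"
    using pos by (simp add: eq)
  have "((\<lambda>t. \<Sum>j<n. (F t j)\<^sup>2) has_real_derivative (\<Sum>j<n. 2 * (F t0 j * D j))) (at t0)"
    by (rule DERIV_sum) (auto intro!: derivative_eq_intros F)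
  then have "((\<lambda>t. sqrt (\<Sum>j<n. (F t j)\<^sup>2)) has_real_derivative
      inverse (sqrt (\<Sum>j<n. (F t0 j)\<^sup>2)) / 2 * (\<Sum>j<n. 2 * (F t0 j * D j))) (at t0)"
    using gt by (intro DERIV_chain2[OF DERIV_real_sqrt]) auto
  then show ?thesis
    unfolding eq sum_distrib_left[symmetric] by (rule DERIV_cong) (simp add: field_simps)
qed

text \<open>
  The divergence only sees the flux along the \<open>n\<close> coordinate lines through \<open>x\<close>, so the product and
  chain rules of one variable, with \<open>(g\<^sup>q)' = g\<^sup>q (q' ln g + q g' / g)\<close> for the varying exponent,
  are all that is used. The entries \<open>H i j\<close> play the role of the Hessian of \<open>u\<close>.
\<close>

lemma px_laplacian_nondivergence:
  assumes H: "\<And>i j. i < n \<Longrightarrow> j < n \<Longrightarrow>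
      ((\<lambda>t. grad n u (x(i := t)) j) has_real_derivative H i j) (at (x i))"
    and p: "\<And>i. i < n \<Longrightarrow> (\<lambda>t. p (x(i := t))) differentiable (at (x i))"
    and pos: "enorm n (grad n u x) > 0"
  shows "px_laplacian n p u x = enorm n (grad n u x) powr (p x - 2) *
     ((\<Sum>i<n. H i i)
      + (p x - 2) * (\<Sum>i<n. \<Sum>j<n. H i j * grad n u x i * grad n u x j) / (enorm n (grad n u x))\<^sup>2
      + (\<Sum>i<n. grad n p x i * grad n u x i) * ln (enorm n (grad n u x)))"
proof -
  define g where "g = enorm n (grad n u x)"
  define G where "G = grad n u x"
  have g: "g > 0" using pos by (simp add: g_def)
  have part: "partial_deriv i (\<lambda>y. enorm n (grad n u y) powr (p y - 2) * grad n u y i) x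
     = g powr (p x - 2) * (H i i + (p x - 2) * (\<Sum>j<n. H i j * G i * G j) / g\<^sup>2
        + grad n p x i * G i * ln g)" if i: "i < n" for i
  proof -
    have dp: "((\<lambda>t. p (x(i := t))) has_real_derivative grad n p x i) (at (x i))"
      using p[OF i] i by (simp add: grad_def partial_deriv_def DERIV_deriv_iff_real_differentiable)
    have dg: "((\<lambda>t. enorm n (grad n u (x(i := t)))) has_real_derivative (\<Sum>j<n. G j * H i j) / g) (at (x i))"
      using has_real_derivative_enorm[of n "\<lambda>t. grad n u (x(i := t))" "H i" "x i"] H[OF i] pos
      by (simp add: G_def g_def)
    have dpow: "((\<lambda>t. enorm n (grad n u (x(i := t))) powr (p (x(i := t)) - 2)) has_real_derivative
        g powr (p x - 2) * (grad n p x i * ln g + (\<Sum>j<n. G j * H i j) / g * (p x - 2) / g)) (at (x i))"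
      using DERIV_powr[OF dg _ DERIV_diff[OF dp DERIV_const], of 2] g
      by (simp add: g_def[symmetric])
    have "((\<lambda>t. enorm n (grad n u (x(i := t))) powr (p (x(i := t)) - 2) * grad n u (x(i := t)) i)
       has_real_derivative
        (g powr (p x - 2) * (grad n p x i * ln g + (\<Sum>j<n. G j * H i j) / g * (p x - 2) / g)) * G i
         + H i i * g powr (p x - 2)) (at (x i))"
      using DERIV_mult[OF dpow H[OF i i]] by (simp add: g_def G_def)
    moreover have "(\<Sum>j<n. H i j * G i * G j) = G i * (\<Sum>j<n. G j * H i j)"
      by (simp add: sum_distrib_left mult_ac)
    ultimately show ?thesis
      using g by (simp add: partial_deriv_def DERIV_imp_deriv field_simps power2_eq_square)
  qed
  have "px_laplacian n p u x = (\<Sum>i<n. g powr (p x - 2) *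
      (H i i + (p x - 2) * (\<Sum>j<n. H i j * G i * G j) / g\<^sup>2 + grad n p x i * G i * ln g))"
    by (simp add: px_laplacian_def divergence_def part)
  also have "\<dots> = g powr (p x - 2) * ((\<Sum>i<n. H i i)
      + (p x - 2) * (\<Sum>i<n. \<Sum>j<n. H i j * G i * G j) / g\<^sup>2 + (\<Sum>i<n. grad n p x i * G i) * ln g)"
    by (simp add: sum_distrib_left[symmetric] sum.distrib sum_distrib_right[symmetric]
        sum_divide_distrib[symmetric])
  finally show ?thesis by (simp add: g_def G_def)
qed

section \<open>Gradient and Hessian of the barriers\<close>

text \<open>
  One family covers both \<open>w\<close> (\<open>a = 0\<close>) and \<open>v\<close> (\<open>a = 1\<close>); the linear part has slope \<open>a\<close> in the last
  coordinate, which is stored at index \<open>n - 1\<close>.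
\<close>

definition barrier ::
  "nat \<Rightarrow> (nat \<Rightarrow> real) \<Rightarrow> real \<Rightarrow> real \<Rightarrow> real \<Rightarrow> real \<Rightarrow> (nat \<Rightarrow> real) \<Rightarrow> real" where
  "barrier n z s a b d x = a * x (n - 1) + b * edist n x z powr (- s) + d"

lemma has_real_derivative_edist:
  assumes "i < n" "edist n x z > 0"
  shows "((\<lambda>t. edist n (x(i := t)) z) has_real_derivative (x i - z i) / edist n x z) (at (x i))"
proof -
  have "((\<lambda>t. enorm n (\<lambda>j. (x(i := t)) j - z j)) has_real_derivative
      (\<Sum>j<n. ((x(i := x i)) j - z j) * of_bool (j = i)) / enorm n (\<lambda>j. (x(i := x i)) j - z j)) (at (x i))"
    using assms(2)
    by (intro has_real_derivative_enorm) (auto simp: edist_def intro!: derivative_eq_intros)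
  moreover have "(\<Sum>j<n. (x j - z j) * of_bool (j = i)) = x i - z i"
    using assms(1) by (simp add: of_bool_def if_distrib cong: if_cong)
  ultimately show ?thesis by (simp add: edist_def)
qed

lemma has_real_derivative_edist_powr:
  assumes "i < n" "edist n x z > 0"
  shows "((\<lambda>t. edist n (x(i := t)) z powr k) has_real_derivative
     k * edist n x z powr (k - 2) * (x i - z i)) (at (x i))"
proof -
  have "((\<lambda>t. edist n (x(i := t)) z powr k) has_real_derivative
     k * edist n x z powr (k - 1) * ((x i - z i) / edist n x z)) (at (x i))"
    using DERIV_fun_powr[OF has_real_derivative_edist[OF assms], of k] assms by simp
  moreover have "edist n x z powr (k - 1) = edist n x z powr (k - 2) * edist n x z"
    using assms powr_add[of "edist n x z" "k - 2" 1] by simp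
  ultimately show ?thesis using assms by (simp add: mult.assoc)
qed

lemma grad_barrier:
  assumes "edist n x z > 0" "i < n"
  shows "grad n (barrier n z s a b d) x i =
     a * of_bool (i = n - 1) - b * s * edist n x z powr (- s - 2) * (x i - z i)"
proof -
  have "((\<lambda>t. (x(i := t)) (n - 1)) has_real_derivative of_bool (i = n - 1)) (at (x i))"
    by (auto simp: fun_upd_def)
  then have "((\<lambda>t. barrier n z s a b d (x(i := t))) has_real_derivative
      a * of_bool (i = n - 1) + b * (- s * edist n x z powr (- s - 2) * (x i - z i)) + 0) (at (x i))"
    unfolding barrier_def
    by (intro DERIV_add DERIV_cmult DERIV_const has_real_derivative_edist_powr assms)
  then show ?thesis
    using assms by (simp add: grad_def partial_deriv_def DERIV_imp_deriv)
qed

text \<open>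
  The gradient formula holds only away from \<open>z\<close>, so it may only be differentiated after restricting the
  coordinate line to a neighbourhood of \<open>x\<close> that avoids \<open>z\<close>.
\<close>

lemma hessian_barrier:
  assumes pos: "edist n x z > 0" and ij: "i < n" "j < n"
  shows "((\<lambda>t. grad n (barrier n z s a b d) (x(i := t)) j) has_real_derivative
     b * s * edist n x z powr (- s - 2) *
       ((s + 2) * (x i - z i) * (x j - z j) / (edist n x z)\<^sup>2 - of_bool (i = j))) (at (x i))"
proof -
  have "isCont (\<lambda>t. edist n (x(i := t)) z) (x i)"
    using has_real_derivative_edist[OF ij(1) pos] by (rule DERIV_isCont)
  then have "((\<lambda>t. edist n (x(i := t)) z) \<longlongrightarrow> edist n x z) (at (x i))"
    by (simp add: isCont_def)
  then have ev: "\<forall>\<^sub>F t in at (x i). edist n (x(i := t)) z > 0"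
    using pos by (rule order_tendstoD)
  then have ev': "\<forall>\<^sub>F t in at (x i). grad n (barrier n z s a b d) (x(i := t)) j =
     a * of_bool (j = n - 1)
       - b * s * (edist n (x(i := t)) z powr (- s - 2) * ((x(i := t)) j - z j))"
    by eventually_elim (simp add: grad_barrier ij mult.assoc)
  have "((\<lambda>t. (x(i := t)) j - z j) has_real_derivative of_bool (i = j)) (at (x i))"
    by (auto simp: fun_upd_def intro!: derivative_eq_intros)
  from DERIV_mult[OF has_real_derivative_edist_powr[OF ij(1) pos, of "- s - 2"] this]
  have d: "((\<lambda>t. a * of_bool (j = n - 1)
       - b * s * (edist n (x(i := t)) z powr (- s - 2) * ((x(i := t)) j - z j))) has_real_derivative
     0 - b * s * ((- s - 2) * edist n x z powr (- s - 2 - 2) * (x i - z i) * (x j - z j)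
        + of_bool (i = j) * edist n x z powr (- s - 2))) (at (x i))"
    by (intro DERIV_diff DERIV_const DERIV_cmult) simp
  have e: "edist n x z powr (- s - 2 - 2) = edist n x z powr (- s - 2) / (edist n x z)\<^sup>2"
    using pos powr_diff[of "edist n x z" "- s - 2" 2] by (simp add: powr_numeral)
  have "((\<lambda>t. grad n (barrier n z s a b d) (x(i := t)) j) has_real_derivative
     0 - b * s * ((- s - 2) * edist n x z powr (- s - 2 - 2) * (x i - z i) * (x j - z j)
        + of_bool (i = j) * edist n x z powr (- s - 2))) (at (x i))"
    by (rule iffD2[OF has_field_derivative_cong_eventually[OF ev'] d])
      (use pos ij in \<open>simp add: grad_barrier mult.assoc\<close>)
  then show ?thesis
    unfolding e by (rule DERIV_cong) (use pos in \<open>simp add: field_simps\<close>)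
qed

section \<open>Lower bound for the operator on a barrier\<close>

lemma enorm_nonneg [simp]: "enorm n y \<ge> 0"
  by (simp add: enorm_def)

lemma enorm_power2: "(enorm n y)\<^sup>2 = (\<Sum>i<n. (y i)\<^sup>2)"
  by (simp add: enorm_def L2_set_def sum_nonneg)

lemma abs_sum_mult_le_enorm: "\<bar>\<Sum>i<n. y i * z i\<bar> \<le> enorm n y * enorm n z"
proof -
  have "\<bar>\<Sum>i<n. y i * z i\<bar> \<le> (\<Sum>i<n. \<bar>y i\<bar> * \<bar>z i\<bar>)"
    using sum_abs[of "\<lambda>i. y i * z i" "{..<n}"] by (simp add: abs_mult)
  also have "\<dots> \<le> enorm n y * enorm n z"
    unfolding enorm_def by (rule L2_set_mult_ineq)
  finally show ?thesis .
qed

text \<open>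
  The number \<open>\<sigma>\<close> is the squared cosine of the angle between \<open>\<nabla>u\<close> and the radial direction, and its
  bounds are the Cauchy-Schwarz inequality. The Hessian is a rank-one radial matrix minus a
  multiple of the identity, so no other information about \<open>\<nabla>u\<close> enters the quadratic form.
\<close>

lemma px_laplacian_barrier:
  fixes n z s a b d
  defines "u \<equiv> barrier n z s a b d"
  assumes r: "edist n x z > 0" and g: "enorm n (grad n u x) > 0"
    and p: "\<And>i. i < n \<Longrightarrow> (\<lambda>t. p (x(i := t))) differentiable (at (x i))"
  obtains \<sigma> where "0 \<le> \<sigma>" "\<sigma> \<le> 1"
    "px_laplacian n p u x = enorm n (grad n u x) powr (p x - 2) *
       (b * s * edist n x z powr (- s - 2) * (s + 2 - n + (p x - 2) * ((s + 2) * \<sigma> - 1))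
        + (\<Sum>i<n. grad n p x i * grad n u x i) * ln (enorm n (grad n u x)))"
proof
  let ?r = "edist n x z" and ?g = "enorm n (grad n u x)" and ?G = "grad n u x"
  define e where "e i = x i - z i" for i
  define K where "K = b * s * ?r powr (- s - 2)"
  define S where "S = (\<Sum>i<n. e i * ?G i)"
  define H where "H i j = K * ((s + 2) * e i * e j / ?r\<^sup>2 - of_bool (i = j))" for i j
  define \<sigma> where "\<sigma> = (S / (?r * ?g))\<^sup>2"
  have er: "enorm n e = ?r" by (simp add: e_def[abs_def] edist_def)
  show "0 \<le> \<sigma>" by (simp add: \<sigma>_def)
  have "\<bar>S\<bar> \<le> ?r * ?g"
    using abs_sum_mult_le_enorm[of e ?G n] by (simp add: S_def er)
  then have "\<bar>S / (?r * ?g)\<bar> \<le> 1"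
    using r g by (simp add: abs_mult abs_divide)
  then show "\<sigma> \<le> 1"
    unfolding \<sigma>_def by (simp add: abs_square_le_1)
  have tr: "(\<Sum>i<n. H i i) = K * (s + 2 - n)"
  proof -
    have "(\<Sum>i<n. H i i) = K * ((s + 2) * (\<Sum>i<n. (e i)\<^sup>2) / ?r\<^sup>2 - n)"
      by (simp add: H_def sum_distrib_left[symmetric] sum_subtractf sum_divide_distrib[symmetric]
          power2_eq_square mult.assoc)
    then show ?thesis using r by (simp add: enorm_power2[symmetric] er)
  qed
  have quad: "(\<Sum>i<n. \<Sum>j<n. H i j * ?G i * ?G j) = K * ((s + 2) * S\<^sup>2 / ?r\<^sup>2 - ?g\<^sup>2)"
  proof -
    have "(\<Sum>j<n. H i j * ?G i * ?G j) = K * (s + 2) / ?r\<^sup>2 * S * (e i * ?G i) - K * (?G i)\<^sup>2"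
      if "i < n" for i
    proof -
      have "(\<Sum>j<n. H i j * ?G i * ?G j) = (\<Sum>j<n. K * (s + 2) / ?r\<^sup>2 * (e i * ?G i) * (e j * ?G j)
          - K * ?G i * (of_bool (i = j) * ?G j))"
        by (intro sum.cong) (simp_all add: H_def algebra_simps)
      also have "\<dots> = K * (s + 2) / ?r\<^sup>2 * (e i * ?G i) * S
          - K * ?G i * (\<Sum>j<n. of_bool (i = j) * ?G j)"
        unfolding S_def by (simp only: sum_subtractf sum_distrib_left)
      also have "(\<Sum>j<n. of_bool (i = j) * ?G j) = ?G i"
        using that by (simp add: of_bool_def if_distrib if_distribR cong: if_cong)
      finally show ?thesis by (simp add: power2_eq_square)
    qed
    then have "(\<Sum>i<n. \<Sum>j<n. H i j * ?G i * ?G j)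
        = (\<Sum>i<n. K * (s + 2) / ?r\<^sup>2 * S * (e i * ?G i) - K * (?G i)\<^sup>2)"
      by (intro sum.cong) auto
    also have "\<dots> = K * (s + 2) / ?r\<^sup>2 * S * S - K * (\<Sum>i<n. (?G i)\<^sup>2)"
      by (simp only: sum_subtractf sum_distrib_left[symmetric] S_def[symmetric])
    finally show ?thesis
      unfolding enorm_power2[of n ?G] by (simp add: power2_eq_square algebra_simps)
  qed
  have "px_laplacian n p u x = ?g powr (p x - 2) *
     ((\<Sum>i<n. H i i) + (p x - 2) * (\<Sum>i<n. \<Sum>j<n. H i j * ?G i * ?G j) / ?g\<^sup>2
      + (\<Sum>i<n. grad n p x i * ?G i) * ln ?g)"
    using hessian_barrier[OF r] g p unfolding u_def H_def K_def e_def
    by (intro px_laplacian_nondivergence)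
  also have "(\<Sum>i<n. H i i) + (p x - 2) * (\<Sum>i<n. \<Sum>j<n. H i j * ?G i * ?G j) / ?g\<^sup>2
      = K * (s + 2 - n + (p x - 2) * ((s + 2) * \<sigma> - 1))"
    unfolding tr quad \<sigma>_def using r g by (simp add: field_simps)
  finally show "px_laplacian n p u x = ?g powr (p x - 2) *
       (b * s * ?r powr (- s - 2) * (s + 2 - n + (p x - 2) * ((s + 2) * \<sigma> - 1))
        + (\<Sum>i<n. grad n p x i * ?G i) * ln ?g)"
    by (simp add: K_def)
qed

text \<open>
  The summand \<open>n / (p_min - 1)\<close> makes \<open>s (p - 1) \<ge> n\<close>, which is what a radial gradient needs; the
  summand \<open>n + p_max\<close> serves a gradient orthogonal to the radius.
\<close>

definition barrier_exponent :: "nat \<Rightarrow> real \<Rightarrow> real \<Rightarrow> real" where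
  "barrier_exponent n p_min p_max = n + p_max + n / (p_min - 1)"

text \<open>
  The expression is affine in \<open>\<sigma>\<close>, hence a convex combination of its values at \<open>\<sigma> = 1\<close>
  (\<open>radial\<close>) and \<open>\<sigma> = 0\<close> (\<open>tangential\<close>).
\<close>

lemma barrier_exponent_bracket:
  fixes n :: nat and p_min p_max q \<sigma> :: real
  defines "s \<equiv> barrier_exponent n p_min p_max"
  assumes "1 < p_min" "p_min \<le> q" "q \<le> p_max" "0 \<le> \<sigma>" "\<sigma> \<le> 1"
  shows "1 \<le> s + 2 - n + (q - 2) * ((s + 2) * \<sigma> - 1)"
proof -
  have nn: "n / (p_min - 1) \<ge> 0" using assms by simp
  have "n = n / (p_min - 1) * (p_min - 1)" using assms by simp
  also have "\<dots> \<le> s * (q - 1)"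
    using assms nn by (intro mult_mono) (auto simp: s_def barrier_exponent_def)
  finally have s1: "real n \<le> s * (q - 1)" .
  have s0: "s \<ge> n + q"
    using add_increasing2[OF nn \<open>q \<le> p_max\<close>] by (simp add: s_def barrier_exponent_def)
  have radial: "1 \<le> s + 2 - n + (q - 2) * (s + 1)"
    using s1 assms by (simp add: algebra_simps)
  have tangential: "1 \<le> s + 2 - n - (q - 2)"
    using s0 by simp
  have "1 \<le> \<sigma> * (s + 2 - n + (q - 2) * (s + 1)) + (1 - \<sigma>) * (s + 2 - n - (q - 2))"
    using mult_left_mono[OF radial, of \<sigma>]
      mult_left_mono[OF tangential, of "1 - \<sigma>"] assms by (simp add: algebra_simps)
  then show ?thesis by (simp add: algebra_simps)
qed

text \<open>
  Radial convexity of \<open>|x - z|\<^sup>-\<^sup>s\<close> competes with the variation of \<open>p\<close>. Only the sizes of \<open>\<nabla>u\<close>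
  and \<open>\<nabla>p\<close> are left, so the estimate applies verbatim to \<open>w\<close> and to \<open>v\<close>.
\<close>

lemma px_laplacian_barrier_ge:
  fixes n z a b d p_min p_max
  defines "s \<equiv> barrier_exponent n p_min p_max"
  defines "u \<equiv> barrier n z s a b d"
  defines "g \<equiv> \<lambda>x. enorm n (grad n u x)"
  assumes pm: "1 < p_min" "p_min \<le> p x" "p x \<le> p_max" and b: "0 < b"
    and r: "edist n x z > 0" and g: "g x > 0"
    and p: "\<And>i. i < n \<Longrightarrow> (\<lambda>t. p (x(i := t))) differentiable (at (x i))"
    and \<delta>: "enorm n (grad n p x) \<le> \<delta>"
  shows "g x powr (p x - 2) * (b * s * edist n x z powr (- s - 2) - \<delta> * g x * \<bar>ln (g x)\<bar>)
    \<le> px_laplacian n p u x"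
proof -
  let ?P = "\<Sum>i<n. grad n p x i * grad n u x i"
  have s: "s \<ge> 0" using pm by (simp add: s_def barrier_exponent_def)
  obtain \<sigma> where \<sigma>: "0 \<le> \<sigma>" "\<sigma> \<le> 1" and
    eq: "px_laplacian n p u x = g x powr (p x - 2) *
       (b * s * edist n x z powr (- s - 2) * (s + 2 - n + (p x - 2) * ((s + 2) * \<sigma> - 1))
        + ?P * ln (g x))"
    using px_laplacian_barrier[OF r g[unfolded g_def u_def] p] unfolding g_def u_def by blast
  have "b * s * edist n x z powr (- s - 2) * 1
     \<le> b * s * edist n x z powr (- s - 2) * (s + 2 - n + (p x - 2) * ((s + 2) * \<sigma> - 1))"
    using barrier_exponent_bracket[OF pm \<sigma>] b s by (intro mult_left_mono) (auto simp: s_def)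
  moreover have "- (\<delta> * g x * \<bar>ln (g x)\<bar>) \<le> ?P * ln (g x)"
  proof -
    have "\<bar>?P * ln (g x)\<bar> \<le> enorm n (grad n p x) * g x * \<bar>ln (g x)\<bar>"
      unfolding abs_mult g_def by (intro mult_right_mono abs_sum_mult_le_enorm) auto
    also have "\<dots> \<le> \<delta> * g x * \<bar>ln (g x)\<bar>"
      using \<delta> g by (intro mult_right_mono) auto
    finally show ?thesis by linarith
  qed
  ultimately show ?thesis
    unfolding eq by (intro mult_left_mono) auto
qed

lemma enorm_minus_scaled_le:
  assumes "c \<ge> 0"
  shows "enorm n (\<lambda>i. e i - c * y i) \<le> enorm n e + c * enorm n y"
    and "enorm n e \<le> enorm n (\<lambda>i. e i - c * y i) + c * enorm n y"
proof -
  have sc: "L2_set (\<lambda>i. c * y i) {..<n} = c * L2_set y {..<n}"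
    using assms by (simp add: L2_set_right_distrib)
  have sc': "L2_set (\<lambda>i. - (c * y i)) {..<n} = c * L2_set y {..<n}"
    using sc by (simp add: L2_set_def)
  show "enorm n (\<lambda>i. e i - c * y i) \<le> enorm n e + c * enorm n y"
    using L2_set_triangle_ineq[of e "\<lambda>i. - (c * y i)" "{..<n}"] by (simp add: enorm_def sc')
  show "enorm n e \<le> enorm n (\<lambda>i. e i - c * y i) + c * enorm n y"
    using L2_set_triangle_ineq[of "\<lambda>i. e i - c * y i" "\<lambda>i. c * y i" "{..<n}"]
    by (simp add: enorm_def sc)
qed

lemma enorm_grad_barrier:
  assumes n: "n \<ge> 1" and r: "edist n x z > 0" and "b \<ge> 0" "s \<ge> 0"
  shows "\<bar>enorm n (grad n (barrier n z s 1 b d) x) - 1\<bar> \<le> b * s * edist n x z powr (- s - 1)"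
    and "enorm n (grad n (barrier n z s 0 b d) x) = b * s * edist n x z powr (- s - 1)"
proof -
  let ?r = "edist n x z"
  let ?c = "b * s * ?r powr (- s - 2)"
  have c: "?c \<ge> 0" using assms by simp
  have "?r powr (- s - 2) * ?r = ?r powr (- s - 1)"
  proof -
    have "- s - 1 = (- s - 2) + 1" by simp
    then show ?thesis using r by (simp only: powr_add) simp
  qed
  then have cr: "?c * enorm n (\<lambda>i. x i - z i) = b * s * ?r powr (- s - 1)"
    by (simp add: edist_def)
  have G: "enorm n (grad n (barrier n z s a b d) x)
      = enorm n (\<lambda>i. a * of_bool (i = n - 1) - ?c * (x i - z i))" for a
    unfolding enorm_def by (rule L2_set_cong) (auto simp: grad_barrier[OF r])
  have "(enorm n (\<lambda>i. of_bool (i = n - 1)))\<^sup>2 = 1"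
  proof -
    have "(of_bool (i = n - 1) :: real)\<^sup>2 = (if i = n - 1 then 1 else 0)" for i by simp
    then show ?thesis using n unfolding enorm_power2 by simp
  qed
  then have e1: "enorm n (\<lambda>i. of_bool (i = n - 1)) = 1"
    using enorm_nonneg by (simp add: power2_eq_1_iff) (metis enorm_nonneg not_one_le_zero neg_0_le_iff_le)
  show "\<bar>enorm n (grad n (barrier n z s 1 b d) x) - 1\<bar> \<le> b * s * ?r powr (- s - 1)"
    using enorm_minus_scaled_le[OF c, of n "\<lambda>i. of_bool (i = n - 1)" "\<lambda>i. x i - z i"]
    unfolding G cr e1 by simp
  have "enorm n (\<lambda>i. - (?c * (x i - z i))) = ?c * enorm n (\<lambda>i. x i - z i)"
    using c L2_set_right_distrib[of ?c "\<lambda>i. x i - z i" "{..<n}"]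
    by (simp add: enorm_def L2_set_def)
  then show "enorm n (grad n (barrier n z s 0 b d) x) = b * s * ?r powr (- s - 1)"
    unfolding G cr[symmetric] by simp
qed

section \<open>The constants\<close>

lemma barrier_exponent_ge_1:
  assumes "1 < p_min" "p_min \<le> p_max"
  shows "1 \<le> barrier_exponent n p_min p_max"
proof -
  have "0 \<le> n / (p_min - 1)" using assms by simp
  then show ?thesis using assms unfolding barrier_exponent_def by linarith
qed

lemma powr_neg_ge_1:
  fixes r k :: real
  assumes "0 < r" "r \<le> 1" "k \<le> 0"
  shows "1 \<le> r powr k"
  using powr_mono2'[of k r 1] assms by simp

text \<open>
  Powers are monotone in the exponent, increasing or decreasing according to whether the base
  exceeds \<open>1\<close>; hence the minimum over an interval of exponents is attained at an endpoint.
\<close>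

lemma min_powr_le_powr:
  fixes c :: real
  assumes "0 < c" "\<alpha> \<le> k" "k \<le> \<beta>"
  shows "min (c powr \<alpha>) (c powr \<beta>) \<le> c powr k"
proof (cases "1 \<le> c")
  case True
  then show ?thesis using powr_mono[OF assms(2) True] by simp
next
  case False
  then show ?thesis using powr_mono'[OF assms(3), of c] assms(1) by simp
qed

text \<open>
  Half of the smallest value that \<open>c\<^sup>p\<^sup>-\<^sup>1\<close> can take; the other half is given away to the gradient
  of \<open>p\<close>.
\<close>

definition slope_floor :: "real \<Rightarrow> real \<Rightarrow> real \<Rightarrow> real" where
  "slope_floor p_min p_max c = min (c powr (p_min - 1)) (c powr (p_max - 1)) / 2"

text \<open>
  On \<open>r \<le> |x - z| \<le> 1\<close> the quantity \<open>|ln (c * s)| + (s + 1) |ln r|\<close> bounds \<open>|log |\<nabla>w||\<close>. Below this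
  threshold \<open>\<epsilon> |log |\<nabla>w|| \<le> 1 / 2\<close>. The cap at \<open>1\<close> gives \<open>\<epsilon>\<^sup>1\<^sup>+\<^sup>\<theta> \<le> \<epsilon>\<close>, which is how \<open>\<theta>\<close> stays out
  of the constant.
\<close>

definition radial_threshold :: "nat \<Rightarrow> real \<Rightarrow> real \<Rightarrow> real \<Rightarrow> real \<Rightarrow> real" where
  "radial_threshold n p_min p_max r c =
     (let s = barrier_exponent n p_min p_max
      in min 1 (1 / (2 * (1 + \<bar>ln (c * s)\<bar> + (s + 1) * \<bar>ln r\<bar>))))"

text \<open>
  The three bounds on \<open>\<epsilon>\<close> serve three purposes: the first keeps \<open>\<nabla>v\<close> within \<open>1 / 2\<close> of a unit
  vector, the second makes \<open>\<epsilon>\<^sup>\<theta> \<le> c\<^sub>0 c / 8\<close>, so that the logarithmic term costs at most half of the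
  convexity term, and the third makes \<open>\<epsilon>\<^sup>2\<close> smaller than what remains.
\<close>

definition tilted_threshold ::
  "nat \<Rightarrow> real \<Rightarrow> real \<Rightarrow> real \<Rightarrow> real \<Rightarrow> real \<Rightarrow> real \<Rightarrow> real" where
  "tilted_threshold n p_min p_max r c\<^sub>0 c \<theta> =
     (let s = barrier_exponent n p_min p_max
      in min (1 / (c\<^sub>0 * c * s * r powr (- s - 1)))
           (min ((c\<^sub>0 * c / 8) powr (1 / \<theta>)) (2 powr (- p_max) * c\<^sub>0 * c / 8)))"

lemma slope_floor_pos: "0 < c \<Longrightarrow> 0 < slope_floor p_min p_max c"
  by (simp add: slope_floor_def)

lemma radial_threshold_pos:
  assumes "1 < p_min" "p_min \<le> p_max"
  shows "0 < radial_threshold n p_min p_max r c"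
  using barrier_exponent_ge_1[OF assms, of n]
  by (simp add: radial_threshold_def Let_def add_pos_nonneg)

lemma tilted_threshold_pos:
  assumes "1 < p_min" "p_min \<le> p_max" "0 < r" "0 < c\<^sub>0" "0 < c"
  shows "0 < tilted_threshold n p_min p_max r c\<^sub>0 c \<theta>"
  using barrier_exponent_ge_1[OF assms(1,2), of n] assms
  by (simp add: tilted_threshold_def Let_def)

section \<open>The radial and the tilted barrier\<close>

text \<open>
  The gradient has length \<open>g = c s r\<^sup>-\<^sup>s\<^sup>-\<^sup>1 \<ge> c\<close> because \<open>s \<ge> 1\<close> and \<open>r \<le> 1\<close>, where \<open>r = |x - z|\<close>. The
  convexity term is \<open>g / r \<ge> g\<close> and the logarithmic term at most \<open>g / 2\<close>, leaving
  \<open>g\<^sup>p\<^sup>-\<^sup>1 / 2 \<ge> c\<^sup>p\<^sup>-\<^sup>1 / 2\<close>.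
\<close>

lemma px_laplacian_radial_barrier_ge:
  fixes n p_min p_max c
  defines "s \<equiv> barrier_exponent n p_min p_max"
  assumes n: "n \<ge> 1" and pm: "1 < p_min" "p_min \<le> p x" "p x \<le> p_max" and c: "0 < c"
    and r: "0 < r" "r \<le> edist n x z" "edist n x z \<le> 1"
    and p: "\<And>i. i < n \<Longrightarrow> (\<lambda>t. p (x(i := t))) differentiable (at (x i))"
    and \<theta>: "0 < \<theta>" and \<epsilon>: "0 < \<epsilon>" "\<epsilon> \<le> radial_threshold n p_min p_max r c"
    and dp: "enorm n (grad n p x) \<le> \<epsilon> powr (1 + \<theta>)"
  shows "slope_floor p_min p_max c \<le> px_laplacian n p (barrier n z s 0 c d) x"
proof -
  let ?r = "edist n x z" and ?u = "barrier n z s 0 c d"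
  define g where "g = enorm n (grad n ?u x)"
  define L where "L = \<bar>ln (c * s)\<bar> + (s + 1) * \<bar>ln r\<bar>"
  have s: "1 \<le> s" using barrier_exponent_ge_1 pm by (simp add: s_def)
  have L: "0 \<le> L" using s by (simp add: L_def)
  have g_eq: "g = c * s * ?r powr (- s - 1)"
    unfolding g_def using enorm_grad_barrier(2)[OF n, of x z c s d] r c s by simp
  have "c * 1 * 1 \<le> c * s * ?r powr (- s - 1)"
    using c s r powr_neg_ge_1[of ?r "- s - 1"] by (intro mult_mono) auto
  then have g: "c \<le> g" "0 < g" using c unfolding g_eq by linarith+
  have "\<bar>ln g\<bar> \<le> L"
  proof -
    have "ln g = ln (c * s) + (- s - 1) * ln ?r"
      unfolding g_eq using c s r by (simp add: ln_mult ln_powr)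
    moreover have "\<bar>(- s - 1) * ln ?r\<bar> = (s + 1) * \<bar>ln ?r\<bar>"
      unfolding abs_mult using s by simp
    moreover have "\<bar>ln ?r\<bar> \<le> \<bar>ln r\<bar>"
    proof -
      have "ln r \<le> ln ?r" "ln ?r \<le> 0" using r by auto
      then show ?thesis by linarith
    qed
    ultimately show ?thesis
      unfolding L_def using s mult_left_mono[of "\<bar>ln ?r\<bar>" "\<bar>ln r\<bar>" "s + 1"] by linarith
  qed
  moreover have "\<epsilon> powr (1 + \<theta>) \<le> 1 / (2 * (1 + L))"
  proof -
    have "\<epsilon> \<le> 1" "\<epsilon> \<le> 1 / (2 * (1 + L))"
      using \<epsilon> by (auto simp: radial_threshold_def Let_def L_def s_def add.assoc)
    then show ?thesis
      using powr_mono'[of 1 "1 + \<theta>" \<epsilon>] \<theta> \<epsilon> by simp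
  qed
  ultimately have "\<epsilon> powr (1 + \<theta>) * \<bar>ln g\<bar> \<le> 1 / (2 * (1 + L)) * L"
    using L by (intro mult_mono) auto
  also have "\<dots> \<le> 1 / 2" using L by (simp add: field_simps)
  finally have small: "\<epsilon> powr (1 + \<theta>) * \<bar>ln g\<bar> \<le> 1 / 2" .
  have curv: "g \<le> c * s * ?r powr (- s - 2)"
    unfolding g_eq using powr_mono'[of "- s - 2" "- s - 1" ?r] r c s by (intro mult_left_mono) auto
  have "slope_floor p_min p_max c \<le> c powr (p x - 1) / 2"
    unfolding slope_floor_def using min_powr_le_powr[OF c] pm by (intro divide_right_mono) auto
  also have "\<dots> \<le> g powr (p x - 1) / 2"
    using powr_mono2[of "p x - 1" c g] c g pm by simp
  also have "\<dots> = g powr (p x - 2) * (g / 2)"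
    using powr_add[of g "p x - 2" 1] g by simp
  also have "\<dots> \<le> g powr (p x - 2) * (c * s * ?r powr (- s - 2) - \<epsilon> powr (1 + \<theta>) * g * \<bar>ln g\<bar>)"
  proof (rule mult_left_mono)
    have "\<epsilon> powr (1 + \<theta>) * g * \<bar>ln g\<bar> \<le> g / 2"
      using mult_left_mono[OF small, of g] g by (simp add: mult_ac)
    then show "g / 2 \<le> c * s * ?r powr (- s - 2) - \<epsilon> powr (1 + \<theta>) * g * \<bar>ln g\<bar>"
      using curv by linarith
  qed simp
  also have "\<dots> \<le> px_laplacian n p ?u x"
    unfolding g_def s_def
    using px_laplacian_barrier_ge[where p = p and x = x and z = z and a = 0 and d = d, OF pm c _ _ p dp] r g(2) by (simp add: g_def s_def)
  finally show ?thesis .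
qed

text \<open>
  Since \<open>1 / 2 \<le> |\<nabla>v| \<le> 2\<close>, the factor \<open>|\<nabla>v|\<^sup>p\<^sup>-\<^sup>2\<close> is at least \<open>2\<close> to the power \<open>- p_max\<close> and
  \<open>|log |\<nabla>v|| \<le> 1\<close>. The convexity term is at least \<open>\<epsilon> c\<^sub>0 c / 2\<close> and the logarithmic term at most
  \<open>2 \<epsilon>\<^sup>1\<^sup>+\<^sup>\<theta> \<le> \<epsilon> c\<^sub>0 c / 4\<close>, so a positive multiple of \<open>\<epsilon>\<close> remains.
\<close>

lemma px_laplacian_tilted_barrier_gt:
  fixes n p_min p_max c\<^sub>0 c \<epsilon> d z
  defines "s \<equiv> barrier_exponent n p_min p_max"
  defines "v \<equiv> barrier n z s 1 (c\<^sub>0 / 2 * \<epsilon> * c) d"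
  assumes n: "n \<ge> 1" and pm: "1 < p_min" "p_min \<le> p x" "p x \<le> p_max"
    and c: "0 < c\<^sub>0" "0 < c"
    and r: "0 < r" "r \<le> edist n x z" "edist n x z \<le> 1"
    and p: "\<And>i. i < n \<Longrightarrow> (\<lambda>t. p (x(i := t))) differentiable (at (x i))"
    and \<theta>: "0 < \<theta>" and \<epsilon>: "0 < \<epsilon>" "\<epsilon> \<le> tilted_threshold n p_min p_max r c\<^sub>0 c \<theta>"
    and dp: "enorm n (grad n p x) \<le> \<epsilon> powr (1 + \<theta>)"
  shows "1 / 2 \<le> enorm n (grad n v x) \<and> enorm n (grad n v x) \<le> 2 \<and> \<epsilon>\<^sup>2 < px_laplacian n p v x"
proof -
  let ?r = "edist n x z"
  define b where "b = c\<^sub>0 / 2 * \<epsilon> * c"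
  define g where "g = enorm n (grad n v x)"
  have s: "1 \<le> s" using barrier_exponent_ge_1 pm by (simp add: s_def)
  have b: "0 < b" using c \<epsilon> by (simp add: b_def)
  have \<epsilon>1: "\<epsilon> \<le> 1 / (c\<^sub>0 * c * s * r powr (- s - 1))"
    and \<epsilon>2: "\<epsilon> \<le> (c\<^sub>0 * c / 8) powr (1 / \<theta>)"
    and \<epsilon>3: "\<epsilon> \<le> 2 powr (- p_max) * c\<^sub>0 * c / 8"
    using \<epsilon> by (auto simp: tilted_threshold_def Let_def s_def)
  have "b * s * ?r powr (- s - 1) \<le> b * s * r powr (- s - 1)"
    using powr_mono2'[of "- s - 1" r ?r] r s b by (intro mult_left_mono) auto
  also have "\<dots> = \<epsilon> * (c\<^sub>0 * c * s * r powr (- s - 1)) / 2"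
    by (simp add: b_def)
  also have "\<dots> \<le> 1 / 2"
    using \<epsilon>1 c s r by (simp add: pos_le_divide_eq)
  finally have "b * s * ?r powr (- s - 1) \<le> 1 / 2" .
  moreover have "\<bar>g - 1\<bar> \<le> b * s * ?r powr (- s - 1)"
    unfolding g_def v_def b_def[symmetric] using enorm_grad_barrier(1)[OF n] r b s by simp
  ultimately have g: "1 / 2 \<le> g" "g \<le> 2" "0 < g" by linarith+
  have "\<epsilon> powr (1 + \<theta>) * (g * \<bar>ln g\<bar>) \<le> (\<epsilon> * (c\<^sub>0 * c / 8)) * (2 * 1)"
  proof (intro mult_mono)
    have "\<epsilon> powr \<theta> \<le> c\<^sub>0 * c / 8"
      using powr_mono2[OF _ _ \<epsilon>2, of \<theta>] \<epsilon> \<theta> c by (simp add: powr_powr)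
    then show "\<epsilon> powr (1 + \<theta>) \<le> \<epsilon> * (c\<^sub>0 * c / 8)"
      unfolding powr_add using \<epsilon> by simp
    have "ln g \<le> ln 2" "- ln 2 \<le> ln g"
      using g ln_le_cancel_iff[of g 2] ln_le_cancel_iff[of "1 / 2" g] by (auto simp: ln_div)
    then show "\<bar>ln g\<bar> \<le> 1" using ln_2_less_1 by linarith
  qed (use g c \<epsilon> in auto)
  moreover have "b * 1 * 1 \<le> b * s * ?r powr (- s - 2)"
    using b s r powr_neg_ge_1[of ?r "- s - 2"] by (intro mult_mono) auto
  ultimately have slack: "\<epsilon> * c\<^sub>0 * c / 4
      \<le> b * s * ?r powr (- s - 2) - \<epsilon> powr (1 + \<theta>) * g * \<bar>ln g\<bar>"
    by (simp add: b_def algebra_simps)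
  \<comment> \<open>The sign of \<open>p x - 2\<close> decides which of the two bounds on \<open>g\<close> is needed.\<close>
  have gpow: "2 powr (- p_max) \<le> g powr (p x - 2)"
  proof (cases "p x \<ge> 2")
    case True
    have "2 powr (- p_max) \<le> (2::real) powr (- (p x - 2))" using pm by simp
    also have "\<dots> = (1 / 2) powr (p x - 2)" by (simp only: powr_minus_divide powr_divide powr_one_eq_one)
    also have "\<dots> \<le> g powr (p x - 2)" using True g by (intro powr_mono2) auto
    finally show ?thesis .
  next
    case False
    have "2 powr (- p_max) \<le> (2::real) powr (p x - 2)" using pm by simp
    also have "\<dots> \<le> g powr (p x - 2)" using False g by (intro powr_mono2') auto
    finally show ?thesis .
  qed
  have "\<epsilon>\<^sup>2 \<le> \<epsilon> * (2 powr (- p_max) * c\<^sub>0 * c / 8)"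
    unfolding power2_eq_square using \<epsilon>3 \<epsilon> by (intro mult_left_mono) auto
  also have "\<dots> < 2 powr (- p_max) * (\<epsilon> * c\<^sub>0 * c / 4)"
    using c \<epsilon> by simp
  also have "\<dots> \<le> g powr (p x - 2) *
      (b * s * ?r powr (- s - 2) - \<epsilon> powr (1 + \<theta>) * g * \<bar>ln g\<bar>)"
    using gpow slack c \<epsilon> by (intro mult_mono) auto
  also have "\<dots> \<le> px_laplacian n p v x"
    using px_laplacian_barrier_ge[where p = p and x = x and z = z and a = 1 and d = d, OF pm b _ _ p dp] r g(3)
    by (simp add: g_def v_def b_def s_def)
  finally show ?thesis using g by (simp add: g_def)
qed

theorem lemma4p2:
  shows "\<exists>(\<gamma> :: nat \<Rightarrow> real \<Rightarrow> real \<Rightarrow> real)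
          (c_bar :: real \<Rightarrow> real \<Rightarrow> real \<Rightarrow> real)
          (\<epsilon>\<^sub>0 :: nat \<Rightarrow> real \<Rightarrow> real \<Rightarrow> real \<Rightarrow> real \<Rightarrow> real)
          (\<epsilon>\<^sub>1 :: nat \<Rightarrow> real \<Rightarrow> real \<Rightarrow> real \<Rightarrow> real \<Rightarrow> real \<Rightarrow> real \<Rightarrow> real).
    \<forall>(n :: nat) (p_min :: real) (p_max :: real) (x\<^sub>0 :: nat \<Rightarrow> real) (r\<^sub>1 :: real) (r\<^sub>2 :: real)
     (\<theta> :: real) (c\<^sub>0 :: real) (c\<^sub>1 :: real) (c\<^sub>2 :: real) (c\<^sub>3 :: real).
      n \<ge> 1 \<and> 1 < p_min \<and> p_min \<le> p_max \<and>
      x\<^sub>0 \<in> topspace (Euclidean_space n) \<and> enorm n x\<^sub>0 < 1 \<and>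
      0 < r\<^sub>1 \<and> r\<^sub>1 < r\<^sub>2 \<and> r\<^sub>2 \<le> 1 \<and> 0 < \<theta> \<and> \<theta> \<le> 1 \<and> 0 < c\<^sub>0 \<and> 0 < c\<^sub>1 \<and> 0 < c\<^sub>2 \<longrightarrow>
      (let g = \<gamma> n p_min p_max;
           c = c_bar p_min p_max c\<^sub>1;
           e\<^sub>0 = \<epsilon>\<^sub>0 n p_min p_max r\<^sub>1 c\<^sub>1;
           e\<^sub>1 = \<epsilon>\<^sub>1 n p_min p_max r\<^sub>1 c\<^sub>0 c\<^sub>1 \<theta>
       in g \<ge> 1 \<and> c > 0 \<and> e\<^sub>0 > 0 \<and> e\<^sub>1 > 0 \<and>
          (\<forall>(\<epsilon> :: real) (\<Omega> :: (nat \<Rightarrow> real) set) (p :: (nat \<Rightarrow> real) \<Rightarrow> real).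
             \<epsilon> > 0 \<and> domain_in n \<Omega> \<and> annulus n x\<^sub>0 r\<^sub>1 r\<^sub>2 \<subseteq> \<Omega> \<and> C1_on n p \<Omega> \<and>
             (\<forall>x\<in>\<Omega>. p_min \<le> p x \<and> p x \<le> p_max) \<and>
             (\<forall>x\<in>\<Omega>. enorm n (grad n p x) \<le> \<epsilon> powr (1 + \<theta>)) \<longrightarrow>
             (let w = (\<lambda>x. c\<^sub>1 * edist n x x\<^sub>0 powr (- g) - c\<^sub>2);
                  q = (\<lambda>x. x (n - 1) + c\<^sub>3);
                  v = (\<lambda>x. q x + c\<^sub>0 / 2 * \<epsilon> * (w x - 1))
              in \<forall>x\<in>annulus n x\<^sub>0 r\<^sub>1 r\<^sub>2.
                   (\<epsilon> \<le> e\<^sub>0 \<longrightarrow> px_laplacian n p w x \<ge> c) \<and>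
                   (\<epsilon> \<le> e\<^sub>1 \<longrightarrow>
                      1 / 2 \<le> enorm n (grad n v x) \<and> enorm n (grad n v x) \<le> 2 \<and>
                      px_laplacian n p v x > \<epsilon>\<^sup>2))))"
proof (rule exI[of _ barrier_exponent], rule exI[of _ slope_floor],
    rule exI[of _ radial_threshold], rule exI[of _ tilted_threshold], intro allI impI, goal_cases)
  case (1 n p_min p_max x\<^sub>0 r\<^sub>1 r\<^sub>2 \<theta> c\<^sub>0 c\<^sub>1 c\<^sub>2 c\<^sub>3)
  then have n: "n \<ge> 1" and pm: "1 < p_min" "p_min \<le> p_max" and r: "0 < r\<^sub>1" "r\<^sub>2 \<le> 1"
    and \<theta>: "0 < \<theta>" and c: "0 < c\<^sub>0" "0 < c\<^sub>1"
    by auto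
  define s where "s = barrier_exponent n p_min p_max"
  have w: "(\<lambda>x. c\<^sub>1 * edist n x x\<^sub>0 powr (- s) - c\<^sub>2) = barrier n x\<^sub>0 s 0 c\<^sub>1 (- c\<^sub>2)"
    by (simp add: barrier_def fun_eq_iff)
  have v: "(\<lambda>x. x (n - 1) + c\<^sub>3 + c\<^sub>0 / 2 * \<epsilon> * (c\<^sub>1 * edist n x x\<^sub>0 powr (- s) - c\<^sub>2 - 1))
      = barrier n x\<^sub>0 s 1 (c\<^sub>0 / 2 * \<epsilon> * c\<^sub>1) (c\<^sub>3 - c\<^sub>0 / 2 * \<epsilon> * (c\<^sub>2 + 1))" for \<epsilon>
    by (simp add: barrier_def fun_eq_iff algebra_simps)
  have pointwise: "(\<epsilon> \<le> radial_threshold n p_min p_max r\<^sub>1 c\<^sub>1 \<longrightarrow>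
        slope_floor p_min p_max c\<^sub>1 \<le> px_laplacian n p (barrier n x\<^sub>0 s 0 c\<^sub>1 d) x) \<and>
      (\<epsilon> \<le> tilted_threshold n p_min p_max r\<^sub>1 c\<^sub>0 c\<^sub>1 \<theta> \<longrightarrow>
        1 / 2 \<le> enorm n (grad n (barrier n x\<^sub>0 s 1 (c\<^sub>0 / 2 * \<epsilon> * c\<^sub>1) e) x) \<and>
        enorm n (grad n (barrier n x\<^sub>0 s 1 (c\<^sub>0 / 2 * \<epsilon> * c\<^sub>1) e) x) \<le> 2 \<and>
        \<epsilon>\<^sup>2 < px_laplacian n p (barrier n x\<^sub>0 s 1 (c\<^sub>0 / 2 * \<epsilon> * c\<^sub>1) e) x)"
    if \<epsilon>: "0 < \<epsilon>" and sub: "annulus n x\<^sub>0 r\<^sub>1 r\<^sub>2 \<subseteq> \<Omega>" and C1: "C1_on n p \<Omega>"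
      and range: "\<forall>x\<in>\<Omega>. p_min \<le> p x \<and> p x \<le> p_max"
      and gradp: "\<forall>x\<in>\<Omega>. enorm n (grad n p x) \<le> \<epsilon> powr (1 + \<theta>)"
      and x: "x \<in> annulus n x\<^sub>0 r\<^sub>1 r\<^sub>2" for \<epsilon> \<Omega> p x d e
  proof -
    have x\<Omega>: "x \<in> \<Omega>" using sub x by auto
    have ann: "r\<^sub>1 \<le> edist n x x\<^sub>0" "edist n x x\<^sub>0 \<le> 1" using x r by (auto simp: annulus_def)
    have diff: "(\<lambda>t. p (x(i := t))) differentiable (at (x i))" if "i < n" for i
      using C1 x\<Omega> that by (auto simp: C1_on_def)
    have px: "p_min \<le> p x" "p x \<le> p_max" "enorm n (grad n p x) \<le> \<epsilon> powr (1 + \<theta>)"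
      using range gradp x\<Omega> by auto
    show ?thesis
      using px_laplacian_radial_barrier_ge[where p = p and x = x, OF n pm(1) px(1,2) c(2) r(1) ann diff \<theta> \<epsilon> _ px(3)]
        px_laplacian_tilted_barrier_gt[where p = p and x = x, OF n pm(1) px(1,2) c r(1) ann diff \<theta> \<epsilon> _ px(3)]
      unfolding s_def by blast
  qed
  show ?case
    unfolding Let_def s_def[symmetric] w v
    using pointwise barrier_exponent_ge_1[OF pm, of n] slope_floor_pos[OF c(2)]
      radial_threshold_pos[OF pm, of n r\<^sub>1 c\<^sub>1] tilted_threshold_pos[OF pm r(1) c, of n \<theta>]
    unfolding s_def[symmetric] by blast
qed

end
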